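(* Let $q_1=(1,1,1)$, $q_2=(-1,-1,1)$, $q_3=(-1,1,-1)$, $q_4=(1,-1,-1)$ be the vertices of a regular tetrahedron in $\mathbb{R}^3$, let $t\in(0,1)$, and let $q_{j+4}=tq_j$ for $j=1,\dots,4$. Suppose that positive masses $m_1,\dots,m_8$ placed at $q_1,\dots,q_8$ form a central configuration. Then $m_1=m_2=m_3=m_4$ and $m_5=m_6=m_7=m_8$.
   Context: A configuration $q=(q_1,\dots,q_N)$ of distinct points in $\mathbb{R}^3$ with masses $m_1,\dots,m_N$ is a central configuration if there exists $c\in\mathbb{R}$ such that $\sum_{j\neq i} m_j\left(\frac{1}{|q_j-q_i|^3}-c\right)(q_j-q_i)=0$ for all $i=1,\dots,N$. *)

theory Defs
  imports "HOL-Analysis.Analysis"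
begin

definition central_configuration ::
  "'i set \<Rightarrow> ('i \<Rightarrow> real ^ 3) \<Rightarrow> ('i \<Rightarrow> real) \<Rightarrow> bool" where
  "central_configuration I q m \<longleftrightarrow>
     inj_on q I \<and>
     (\<exists>c::real. \<forall>i\<in>I.
        (\<Sum>j\<in>I - {i}. (m j * (1 / norm (q j - q i) ^ 3 - c)) *\<^sub>R (q j - q i)) = 0)"

definition tet :: "nat \<Rightarrow> real ^ 3" where
  "tet j = (if j = 1 then vector [1, 1, 1]
            else if j = 2 then vector [-1, -1, 1]
            else if j = 3 then vector [-1, 1, -1]
            else vector [1, -1, -1])"

definition nested_tet :: "real \<Rightarrow> nat \<Rightarrow> real ^ 3" where
  "nested_tet t k = (if k \<le> 4 then tet k else t *\<^sub>R tet (k - 4))"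

end

(* The four vertices e_1, ..., e_4 of the tetrahedron span the space with the single relation
   e_1 + e_2 + e_3 + e_4 = 0. Hence the equation at the i-th body of one shell forces all four
   coefficients of the e_j in it to agree. The coefficients with j \<noteq> i do not depend on i, so they
   agree for all j; comparing the remaining coefficients for two bodies of the same shell cancels
   every contribution of that shell and leaves (1 - t) (s - b) (m - m') = 0, where m and m' are two
   masses of the other shell and s and b are the inverse cubes of the distances between e_i and t e_i
   and between e_i and t e_j. The first distance is the smaller one, so s > b. *)
theory Submission
  imports Defs
begin

lemma atLeastAtMost_1_4: "{1..4::nat} = {1, 2, 3, 4}"
  by auto

lemma tet_cases:
  assumes "k \<in> {1..4::nat}"
  obtains "k = 1" | "k = 2" | "k = 3" | "k = 4"
  using assms unfolding atLeastAtMost_1_4 by blast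

lemma inner_tet:
  assumes "i \<in> {1..4}" "j \<in> {1..4}"
  shows "tet i \<bullet> tet j = (if i = j then 3 else -1)"
  by (rule tet_cases[OF assms(1)]; rule tet_cases[OF assms(2)])
     (simp_all add: tet_def inner_vec_def sum_3)

text \<open>One formula serves every distance in the problem: radial partners, non-partners in
  different shells and, with y = x, the edge \<open>sqrt (8 * x\<^sup>2)\<close> of a single
  shell.\<close>

lemma norm_scaled_tet_diff:
  assumes "i \<in> {1..4}" "j \<in> {1..4}"
  shows "norm (y *\<^sub>R tet j - x *\<^sub>R tet i)
    = (if i = j then sqrt (3 * (y - x)\<^sup>2) else sqrt (3 * x\<^sup>2 + 3 * y\<^sup>2 + 2 * x * y))"
  unfolding norm_eq_sqrt_inner using assms
  by (simp add: inner_diff_left inner_diff_right inner_tet power2_eq_square algebra_simps)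

text \<open>The Gram matrix of the vertices is 4 times the identity minus the all-ones matrix, so
  pairing the relation with \<open>tet k\<close> gives 4 \<open>A k\<close> = sum of all
  \<open>A l\<close>, a value independent of k.\<close>

lemma tet_combination_eq_0:
  assumes "(\<Sum>k\<in>{1..4}. A k *\<^sub>R tet k) = 0" "i \<in> {1..4}" "j \<in> {1..4}"
  shows "A i = A j"
proof -
  have *: "4 * A k = (\<Sum>l\<in>{1..4}. A l)" if "k \<in> {1..4}" for k
  proof -
    have "0 = (\<Sum>l\<in>{1..4}. A l *\<^sub>R tet l) \<bullet> tet k"
      using assms(1) by simp
    also have "\<dots> = (\<Sum>l\<in>{1..4}. (if l = k then 4 * A l else 0) - A l)"
      unfolding inner_sum_left using that by (intro sum.cong) (auto simp: inner_tet)
    also have "\<dots> = 4 * A k - (\<Sum>l\<in>{1..4}. A l)"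
      using that by (simp add: sum_subtractf)
    finally show ?thesis by simp
  qed
  show ?thesis
    using *[OF assms(2)] *[OF assms(3)] by simp
qed

text \<open>Comparison of the coefficients of \<open>tet j\<close> and \<open>tet i\<close>. The
  terms \<open>P i\<close> and \<open>Q i\<close> are added and subtracted on the right so that the
  sum runs over all four indices and is the same for every i.\<close>

lemma shell_coefficients:
  fixes P Q :: "nat \<Rightarrow> real"
  assumes "(\<Sum>k\<in>{1..4}-{i}. P k *\<^sub>R (x *\<^sub>R tet k - x *\<^sub>R tet i)) + \<sigma> *\<^sub>R tet i
      + (\<Sum>k\<in>{1..4}-{i}. Q k *\<^sub>R (y *\<^sub>R tet k - x *\<^sub>R tet i)) = 0"
    and "i \<in> {1..4}" "j \<in> {1..4}" "j \<noteq> i"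
  shows "x * P j + y * Q j
    = \<sigma> + x * (P i + Q i) - x * (\<Sum>k\<in>{1..4}. P k + Q k)"
proof -
  define S where "S = (\<Sum>k\<in>{1..4}-{i}. P k + Q k)"
  \<comment> \<open>Coefficients after expansion: each difference with k \<noteq> i puts -x times
    its weight on \<open>tet i\<close>, and \<open>x * S\<close> collects these.\<close>
  define A where "A k = (if k = i then \<sigma> - x * S else x * P k + y * Q k)" for k
  have S: "(\<Sum>k\<in>{1..4}. P k + Q k) = P i + Q i + S"
    unfolding S_def using assms(2) by (subst sum.remove[of _ i]) auto
  have "(\<Sum>k\<in>{1..4}. A k *\<^sub>R tet k)
      = A i *\<^sub>R tet i + (\<Sum>k\<in>{1..4}-{i}. A k *\<^sub>R tet k)"
    using assms(2) by (subst sum.remove[of _ i]) auto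
  also have "(\<Sum>k\<in>{1..4}-{i}. A k *\<^sub>R tet k)
      = (\<Sum>k\<in>{1..4}-{i}. P k *\<^sub>R (x *\<^sub>R tet k - x *\<^sub>R tet i)
          + Q k *\<^sub>R (y *\<^sub>R tet k - x *\<^sub>R tet i) + (x * (P k + Q k)) *\<^sub>R tet i)"
    by (rule sum.cong) (auto simp: A_def algebra_simps)
  also have "\<dots> = (\<Sum>k\<in>{1..4}-{i}. P k *\<^sub>R (x *\<^sub>R tet k - x *\<^sub>R tet i))
      + (\<Sum>k\<in>{1..4}-{i}. Q k *\<^sub>R (y *\<^sub>R tet k - x *\<^sub>R tet i))
      + (x * S) *\<^sub>R tet i"
    by (simp only: S_def sum.distrib scaleR_sum_left[symmetric] sum_distrib_left[symmetric])
  also have "A i *\<^sub>R tet i + \<dots> = 0"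
    using assms(1) by (simp add: A_def algebra_simps)
  finally have "A j = A i"
    using assms(2,3) by (intro tet_combination_eq_0)
  then show ?thesis
    unfolding S using assms(4) by (simp add: A_def algebra_simps)
qed

text \<open>Equations on the shell of scale x determine the masses r of the shell of scale y.
  Nothing orders x and y, so the lemma applies in both directions.\<close>

lemma opposite_shell_masses_eq:
  fixes p r :: "nat \<Rightarrow> real"
  assumes eq: "\<And>i. i \<in> {1..4} \<Longrightarrow>
      (\<Sum>k\<in>{1..4}-{i}. (p k * (1 / norm (x *\<^sub>R tet k - x *\<^sub>R tet i) ^ 3 - c))
          *\<^sub>R (x *\<^sub>R tet k - x *\<^sub>R tet i))
      + (r i * (1 / norm (y *\<^sub>R tet i - x *\<^sub>R tet i) ^ 3 - c))
          *\<^sub>R (y *\<^sub>R tet i - x *\<^sub>R tet i)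
      + (\<Sum>k\<in>{1..4}-{i}. (r k * (1 / norm (y *\<^sub>R tet k - x *\<^sub>R tet i) ^ 3 - c))
          *\<^sub>R (y *\<^sub>R tet k - x *\<^sub>R tet i)) = 0"
    and xy: "0 < x" "0 < y" "x \<noteq> y"
    and ij: "i \<in> {1..4}" "j \<in> {1..4}"
  shows "r i = r j"
proof (cases "i = j")
  case False
  define a where "a = 1 / sqrt (8 * x\<^sup>2) ^ 3 - c"
  define b where "b = 1 / sqrt (3 * x\<^sup>2 + 3 * y\<^sup>2 + 2 * x * y) ^ 3 - c"
  define s where "s = 1 / sqrt (3 * (y - x)\<^sup>2) ^ 3 - c"
  have coeff: "x * (p l * a) + y * (r l * b) = (y - x) * s * r k + x * (p k * a + r k * b)
      - x * (\<Sum>k\<in>{1..4}. p k * a + r k * b)"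
    if "k \<in> {1..4}" "l \<in> {1..4}" "l \<noteq> k" for k l
  proof (rule shell_coefficients[OF _ that])
    have own: "1 / norm (x *\<^sub>R tet n - x *\<^sub>R tet k) ^ 3 - c = a" if "n \<in> {1..4} - {k}" for n
      using that \<open>k \<in> {1..4}\<close> by (auto simp: norm_scaled_tet_diff a_def power2_eq_square)
    have other: "1 / norm (y *\<^sub>R tet n - x *\<^sub>R tet k) ^ 3 - c = b" if "n \<in> {1..4} - {k}" for n
      using that \<open>k \<in> {1..4}\<close> by (auto simp: norm_scaled_tet_diff b_def)
    have partner: "1 / norm (y *\<^sub>R tet k - x *\<^sub>R tet k) ^ 3 - c = s"
      using \<open>k \<in> {1..4}\<close> by (simp add: norm_scaled_tet_diff s_def)
    have radial: "(r k * s) *\<^sub>R (y *\<^sub>R tet k - x *\<^sub>R tet k) = ((y - x) * s * r k) *\<^sub>R tet k"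
      by (simp add: algebra_simps)
    show "(\<Sum>n\<in>{1..4}-{k}. (p n * a) *\<^sub>R (x *\<^sub>R tet n - x *\<^sub>R tet k))
        + ((y - x) * s * r k) *\<^sub>R tet k
        + (\<Sum>n\<in>{1..4}-{k}. (r n * b) *\<^sub>R (y *\<^sub>R tet n - x *\<^sub>R tet k)) = 0"
      using eq[OF \<open>k \<in> {1..4}\<close>]
      by (simp only: own other partner radial cong: sum.cong)
  qed
  \<comment> \<open>A third vertex l makes i and j comparable, both as bodies and as
    coefficients.\<close>
  have "card ({1..4} - {i, j}) = 2"
    using ij False by (subst card_Diff_subset) auto
  then obtain l where l: "l \<in> {1..4}" "l \<noteq> i" "l \<noteq> j"
    by (metis DiffE all_not_in_conv card.empty insertCI zero_neq_numeral)
  \<comment> \<open>The equations at i and j share their left side (coefficient l); those at l for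
    coefficients i and j share their right side. Subtracting within each pair, then eliminating
    \<open>x * a * (p i - p j)\<close>, leaves this product.\<close>
  have "(y - x) * (s - b) * (r i - r j) = 0"
    using coeff[OF ij(1) l(1,2)] coeff[OF ij(2) l(1,3)]
      coeff[OF l(1) ij(1)] coeff[OF l(1) ij(2)] l(2,3)
    by (simp add: algebra_simps)
  moreover have "b < s"
  proof -
    \<comment> \<open>The two sides differ by 8xy > 0.\<close>
    have "3 * (y - x)\<^sup>2 < 3 * x\<^sup>2 + 3 * y\<^sup>2 + 2 * x * y"
      using mult_pos_pos[OF xy(1,2)] by (simp add: power2_eq_square algebra_simps)
    then have "sqrt (3 * (y - x)\<^sup>2) ^ 3 < sqrt (3 * x\<^sup>2 + 3 * y\<^sup>2 + 2 * x * y) ^ 3"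
      by (intro power_strict_mono) auto
    moreover have "0 < sqrt (3 * (y - x)\<^sup>2) ^ 3"
      using xy(3) by simp
    ultimately show ?thesis
      unfolding b_def s_def by (simp add: frac_less2)
  qed
  ultimately show ?thesis
    using xy(3) by auto
qed simp

text \<open>Body i and body i+4 are radial partners. The summands come in the order own shell,
  partner, rest of the other shell, in which the force equation is analysed above.\<close>

lemma sum_two_shells:
  fixes f :: "nat \<Rightarrow> 'a::comm_monoid_add"
  assumes "i \<in> {1..4}"
  shows "sum f ({1..8} - {i}) = sum f ({1..4}-{i}) + f (i+4) + (\<Sum>k\<in>{1..4}-{i}. f (k+4))"
    and "sum f ({1..8} - {i+4}) = (\<Sum>k\<in>{1..4}-{i}. f (k+4)) + f i + sum f ({1..4}-{i})"
proof -
  have eight: "{1..8::nat} = {1, 2, 3, 4, 5, 6, 7, 8}"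
    by auto
  show "sum f ({1..8} - {i}) = sum f ({1..4}-{i}) + f (i+4) + (\<Sum>k\<in>{1..4}-{i}. f (k+4))"
    unfolding eight atLeastAtMost_1_4
    by (rule tet_cases[OF assms]; simp add: insert_Diff_if ac_simps)
  show "sum f ({1..8} - {i+4}) = (\<Sum>k\<in>{1..4}-{i}. f (k+4)) + f i + sum f ({1..4}-{i})"
    unfolding eight atLeastAtMost_1_4
    by (rule tet_cases[OF assms]; simp add: insert_Diff_if ac_simps)
qed

theorem theorem7:
  fixes t :: real and m :: "nat \<Rightarrow> real"
  assumes "0 < t" and "t < 1"
    and "\<forall>i\<in>{1..8}. 0 < m i"
    and "central_configuration {1..8} (nested_tet t) m"
  shows "m 1 = m 2 \<and> m 2 = m 3 \<and> m 3 = m 4 \<and>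
         m 5 = m 6 \<and> m 6 = m 7 \<and> m 7 = m 8"
proof -
  obtain c where c: "\<And>i. i \<in> {1..8} \<Longrightarrow>
      (\<Sum>j\<in>{1..8} - {i}. (m j * (1 / norm (nested_tet t j - nested_tet t i) ^ 3 - c))
        *\<^sub>R (nested_tet t j - nested_tet t i)) = 0"
    using assms(4) unfolding central_configuration_def by blast
  \<comment> \<open>The factor 1 is kept so that both shells have the form scale times
    vertex.\<close>
  have outer: "nested_tet t k = 1 *\<^sub>R tet k" if "k \<in> {1..4}" for k
    using that by (simp add: nested_tet_def)
  have inner: "nested_tet t (k + 4) = t *\<^sub>R tet k" if "k \<in> {1..4}" for k
    using that by (simp add: nested_tet_def)
  \<comment> \<open>The equations at the outer bodies force the inner masses to agree.\<close>
  have inner_masses: "m (i + 4) = m (j + 4)" if "i \<in> {1..4}" "j \<in> {1..4}" for i j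
  proof (rule opposite_shell_masses_eq[where p = m and r = "\<lambda>k. m (k + 4)" and x = 1 and y = t and c = c])
    fix k :: nat
    assume k: "k \<in> {1..4}"
    then have "k \<in> {1..8}" by auto
    from c[OF this] show "(\<Sum>n\<in>{1..4}-{k}. (m n * (1 / norm (1 *\<^sub>R tet n - 1 *\<^sub>R tet k) ^ 3 - c))
          *\<^sub>R (1 *\<^sub>R tet n - 1 *\<^sub>R tet k))
      + (m (k + 4) * (1 / norm (t *\<^sub>R tet k - 1 *\<^sub>R tet k) ^ 3 - c))
          *\<^sub>R (t *\<^sub>R tet k - 1 *\<^sub>R tet k)
      + (\<Sum>n\<in>{1..4}-{k}. (m (n + 4) * (1 / norm (t *\<^sub>R tet n - 1 *\<^sub>R tet k) ^ 3 - c))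
          *\<^sub>R (t *\<^sub>R tet n - 1 *\<^sub>R tet k)) = 0"
      by (simp only: sum_two_shells[OF k] outer inner k outer[OF DiffD1] inner[OF DiffD1] cong: sum.cong)
  qed (use assms that in auto)
  \<comment> \<open>The same argument with the shells exchanged, using the equations at the inner
    bodies.\<close>
  have outer_masses: "m i = m j" if "i \<in> {1..4}" "j \<in> {1..4}" for i j
  proof (rule opposite_shell_masses_eq[where p = "\<lambda>k. m (k + 4)" and r = m and x = t and y = 1 and c = c])
    fix k :: nat
    assume k: "k \<in> {1..4}"
    then have "k + 4 \<in> {1..8}" by auto
    from c[OF this] show "(\<Sum>n\<in>{1..4}-{k}. (m (n + 4) * (1 / norm (t *\<^sub>R tet n - t *\<^sub>R tet k) ^ 3 - c))
          *\<^sub>R (t *\<^sub>R tet n - t *\<^sub>R tet k))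
      + (m k * (1 / norm (1 *\<^sub>R tet k - t *\<^sub>R tet k) ^ 3 - c))
          *\<^sub>R (1 *\<^sub>R tet k - t *\<^sub>R tet k)
      + (\<Sum>n\<in>{1..4}-{k}. (m n * (1 / norm (1 *\<^sub>R tet n - t *\<^sub>R tet k) ^ 3 - c))
          *\<^sub>R (1 *\<^sub>R tet n - t *\<^sub>R tet k)) = 0"
      by (simp only: sum_two_shells[OF k] outer inner k outer[OF DiffD1] inner[OF DiffD1] cong: sum.cong)
  qed (use assms that in auto)
  show ?thesis
    using outer_masses[of 1 2] outer_masses[of 2 3] outer_masses[of 3 4]
      inner_masses[of 1 2] inner_masses[of 2 3] inner_masses[of 3 4]
    by simp
qed

end
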